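(* Let $d\geq 2$ be an integer and $M>0$. Let $G$ be an infinite locally finite connected graph which admits an $M$-uniform packing in $\mathbb{R}^d$. Then we have the following alternative: - either $G$ has positive Cheeger constant, $\mathrm{Cheeger}(G)>0$; - or there are arbitrarily large finite subsets $W$ of vertices of $G$ such that $|\partial W|\leq |W|^{\frac{d-1}{d}+o(1)}$, that is: for every $\varepsilon>0$ and every $N\in\mathbb{N}$ there is a finite set $W$ of vertices of $G$ with $|W|\geq N$ and $|\partial W|\leq |W|^{\frac{d-1}{d}+\varepsilon}$.
   Context: A $d$-sphere packing is a collection $P=(B_v, v\in V)$ of $d$-dimensional closed balls in $\mathbb{R}^d$ with radii $r_v>0$ and pairwise disjoint interiors. Its tangency graph is the unoriented graph with vertex set $V$ in which distinct $u,v$ are joined by an edge if and only if $B_u$ and $B_v$ are tangent. The packing is $M$-uniform if for any tangent balls $B_u,B_v$ one has $r_u/r_v\leq M$. A graph admits an $M$-uniform packing in $\mathbb{R}^d$ if it is (isomorphic to) the tangency graph of an $M$-uniform $d$-sphere packing. For a set $W$ of vertices of $G$, $\partial W$ denotes the set of vertices not in $W$ that are adjacent to some vertex of $W$. The Cheeger constant of an infinite graph $G$ is $$\mathrm{Cheeger}(G)=\inf\Big\{\frac{|\partial W|}{|W|} : W \text{ a finite nonempty set of vertices of } G\Big\}.$$ *)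

theory Defs
  imports
    "Graph_Theory.Pair_Digraph"
    "Graph_Theory.Digraph_Isomorphism"
    "HOL-Analysis.Analysis"
begin

text \<open>
  A simple undirected graph, possibly infinite, is a symmetric loop-free pair digraph
  (locale \<^locale>\<open>pair_bidirected_digraph\<close>): the edge $\{u,v\}$ is the pair of arcs
  $(u,v)$, $(v,u)$.
\<close>

definition locally_finite_graph :: "'v pair_pre_digraph \<Rightarrow> bool" where
  "locally_finite_graph G \<longleftrightarrow> (\<forall>v\<in>pverts G. finite {u. (v, u) \<in> parcs G})"

definition vertex_boundary :: "'v pair_pre_digraph \<Rightarrow> 'v set \<Rightarrow> 'v set" where
  "vertex_boundary G W = {v \<in> pverts G. v \<notin> W \<and> (\<exists>w\<in>W. (w, v) \<in> parcs G)}"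

text \<open>
  Meaningful for locally finite graphs with at least one vertex: then all boundaries of finite
  sets are finite, and the infimum is over a nonempty set of nonnegative reals.
\<close>

definition cheeger :: "'v pair_pre_digraph \<Rightarrow> real" where
  "cheeger G = Inf {real (card (vertex_boundary G W)) / real (card W) | W.
                      W \<subseteq> pverts G \<and> finite W \<and> W \<noteq> {}}"

text \<open>A packing indexed by \<open>V\<close> is given by the centres \<open>c\<close> and the radii \<open>r\<close> of its balls.\<close>

definition sphere_packing :: "'v set \<Rightarrow> ('v \<Rightarrow> real ^ 'n) \<Rightarrow> ('v \<Rightarrow> real) \<Rightarrow> bool" where
  "sphere_packing V c r \<longleftrightarrow>
     (\<forall>v\<in>V. r v > 0) \<and>
     (\<forall>u\<in>V. \<forall>v\<in>V. u \<noteq> v \<longrightarrow> interior (cball (c u) (r u)) \<inter> interior (cball (c v) (r v)) = {})"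

definition tangent_balls :: "real ^ 'n \<Rightarrow> real \<Rightarrow> real ^ 'n \<Rightarrow> real \<Rightarrow> bool" where
  "tangent_balls x r y s \<longleftrightarrow>
     cball x r \<inter> cball y s \<noteq> {} \<and> interior (cball x r) \<inter> interior (cball y s) = {}"

definition tangency_graph ::
    "'v set \<Rightarrow> ('v \<Rightarrow> real ^ 'n) \<Rightarrow> ('v \<Rightarrow> real) \<Rightarrow> 'v pair_pre_digraph" where
  "tangency_graph V c r =
     \<lparr> pverts = V,
       parcs = {(u, v). u \<in> V \<and> v \<in> V \<and> u \<noteq> v \<and> tangent_balls (c u) (r u) (c v) (r v)} \<rparr>"

definition uniform_packing ::
    "real \<Rightarrow> 'v set \<Rightarrow> ('v \<Rightarrow> real ^ 'n) \<Rightarrow> ('v \<Rightarrow> real) \<Rightarrow> bool" where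
  "uniform_packing M V c r \<longleftrightarrow>
     sphere_packing V c r \<and>
     (\<forall>u\<in>V. \<forall>v\<in>V. tangent_balls (c u) (r u) (c v) (r v) \<longrightarrow> r u / r v \<le> M)"

text \<open>
  The type argument fixes the ambient space \<open>real ^ 'n\<close>. Taking the index set of the packing in
  the vertex type of \<open>G\<close> is no restriction, since the tangency graph only has to be isomorphic
  to \<open>G\<close>.
\<close>

definition admits_uniform_packing ::
    "'n::finite itself \<Rightarrow> real \<Rightarrow> 'v pair_pre_digraph \<Rightarrow> bool" where
  "admits_uniform_packing _ M G \<longleftrightarrow>
     (\<exists>(V :: 'v set) (c :: 'v \<Rightarrow> real ^ 'n) r.
        uniform_packing M V c r \<and>
        digraph_iso (with_proj (tangency_graph V c r)) (with_proj G))"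

end

theory Submission
  imports Defs "HOL-Real_Asymp.Real_Asymp"
begin

text \<open>
  Suppose that all finite sets of at least \<open>N\<close> vertices satisfy
  $|\partial W| > |W|^{(d-1)/d+\varepsilon}$; without loss of generality $\varepsilon\leq 1/d$.
  Given a finite set \<open>A\<close> of balls, let $\rho$ be the least radius for which some $B(x,\rho)$ about
  a centre \<open>x\<close> contains at least $m^d$ centres, so that $B(x,3\rho)$ contains at most $(7m)^d$ of them. Averaging over
  the spheres of centre \<open>x\<close> and radius in $[\rho,2\rho]$ yields one that cuts only $O(m^{d-1})$ of the
  balls, and it separates a piece of at most $(7m)^d$ balls from the rest. Carving off pieces
  greedily leaves $|A|(1-O(1/m))$ vertices in pieces of size at most $(7m)^d$ after deleting
  $O(|A|/m)$ vertices. Every piece has boundary at least $c\,m^{-1+d\varepsilon}$ times its size,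
  and all these boundaries consist of deleted vertices and of vertices of $\partial A$. Since degrees
  are bounded in a uniform packing, for large \<open>m\<close> the deleted vertices cannot account for them all,
  so $|\partial A|$ is at least a constant times $|A|$.
\<close>

section \<open>Averaging and volume comparison\<close>

text \<open>Averaging: the window has length 1, so the mean over it of the number of intervals
  containing \<open>t\<close> is at most their total length. Later \<open>t\<close> is the radius of
  a sphere in units of \<rho>, and interval \<open>i\<close> holds the radii at which that sphere
  meets ball \<open>i\<close>.\<close>

lemma exists_point_in_few_intervals:
  fixes a b :: "'i \<Rightarrow> real"
  assumes fin: "finite I" and ab: "\<And>i. i \<in> I \<Longrightarrow> a i \<le> b i"
  shows "\<exists>t\<in>{1..2}. real (card {i\<in>I. a i \<le> t \<and> t \<le> b i}) \<le> (\<Sum>i\<in>I. b i - a i)"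
proof (rule ccontr)
  define L where "L = (\<Sum>i\<in>I. b i - a i)"
  define f :: "real \<Rightarrow> real" where "f = (\<lambda>t. \<Sum>i\<in>I. indicator {a i..b i} t)"
  have f_card: "f t = real (card {i\<in>I. a i \<le> t \<and> t \<le> b i})" for t
    using fin by (simp add: f_def indicator_def sum.If_cases Int_def)
  assume "\<not> ?thesis"
  then have gt: "L < f t" if "t \<in> {1..2}" for t
    using that by (auto simp: f_card L_def not_le)
  \<comment> \<open>integrating \<open>L < f\<close> would only give a weak inequality, so use that \<open>f\<close> is integer-valued\<close>
  have ge: "of_int (\<lfloor>L\<rfloor> + 1) \<le> f t" if "t \<in> {1..2}" for t
  proof -
    have "\<lfloor>L\<rfloor> < int (card {i\<in>I. a i \<le> t \<and> t \<le> b i})"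
      using gt[OF that] by (simp add: f_card floor_less_iff)
    then show ?thesis unfolding f_card by linarith
  qed
  have meas: "{a i..b i} \<inter> {1..2} \<in> lmeasurable" for i
    by (simp add: Int_atLeastAtMost)
  have int: "(indicator {a i..b i} :: real \<Rightarrow> real) integrable_on {1..2}" for i
    using meas by (simp add: integrable_on_indicator)
  have "of_int (\<lfloor>L\<rfloor> + 1) = integral {1..2} (\<lambda>t::real. of_int (\<lfloor>L\<rfloor> + 1) :: real)"
    by simp
  also have "\<dots> \<le> integral {1..2} f"
    using ge int by (intro integral_le) (auto simp: f_def fin intro: integrable_sum)
  also have "\<dots> = (\<Sum>i\<in>I. integral {1..2} (indicator {a i..b i}))"
    unfolding f_def using fin int by (intro integral_sum) auto
  also have "\<dots> \<le> L"
    unfolding L_def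
  proof (rule sum_mono)
    fix i assume "i \<in> I"
    have "integral {1..2} (indicator {a i..b i}) = measure lebesgue ({a i..b i} \<inter> {1..2})"
      by (rule integral_indicator[OF meas])
    also have "\<dots> \<le> measure lebesgue {a i..b i}"
      by (intro measure_mono_fmeasurable) auto
    also have "\<dots> = b i - a i" using ab[OF \<open>i \<in> I\<close>] by simp
    finally show "integral {1..2} (indicator {a i..b i}) \<le> b i - a i" .
  qed
  finally show False by linarith
qed

text \<open>Volume comparison, with the common factor \<open>unit_ball_vol\<close>
  cancelled.\<close>

lemma disjoint_balls_sum_le:
  fixes c :: "'i \<Rightarrow> 'a::euclidean_space"
  assumes fin: "finite F" and pos: "\<And>i. i \<in> F \<Longrightarrow> 0 \<le> r i"
    and disj: "\<And>i j. i \<in> F \<Longrightarrow> j \<in> F \<Longrightarrow> i \<noteq> j \<Longrightarrow> ball (c i) (r i) \<inter> ball (c j) (r j) = {}"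
    and sub: "\<And>i. i \<in> F \<Longrightarrow> ball (c i) (r i) \<subseteq> ball x R" and R: "0 \<le> R"
  shows "(\<Sum>i\<in>F. r i ^ DIM('a)) \<le> R ^ DIM('a)"
proof -
  let ?v = "unit_ball_vol (real DIM('a))"
  have "?v * (\<Sum>i\<in>F. r i ^ DIM('a)) = (\<Sum>i\<in>F. measure lebesgue (ball (c i) (r i)))"
    using pos by (simp add: sum_distrib_left content_ball)
  also have "\<dots> = measure lebesgue (\<Union>i\<in>F. ball (c i) (r i))"
    using fin disj by (intro measure_UNION'[symmetric]) (auto simp: pairwise_def disjnt_def)
  also have "\<dots> \<le> measure lebesgue (ball x R)"
    using sub fin by (intro measure_mono_fmeasurable) auto
  also have "\<dots> = ?v * R ^ DIM('a)" using R by (simp add: content_ball)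
  finally show ?thesis by (simp add: mult_le_cancel_left_pos)
qed

text \<open>The case of equal radii. Writing the outer radius as \<open>K * \<rho>\<close> makes the
  bound independent of scale.\<close>

lemma disjoint_balls_card_le:
  fixes c :: "'i \<Rightarrow> 'a::euclidean_space"
  assumes "finite F" and "0 < \<rho>"
    and "\<And>i j. i \<in> F \<Longrightarrow> j \<in> F \<Longrightarrow> i \<noteq> j \<Longrightarrow> ball (c i) \<rho> \<inter> ball (c j) \<rho> = {}"
    and "\<And>i. i \<in> F \<Longrightarrow> ball (c i) \<rho> \<subseteq> ball x (K * \<rho>)" and "0 \<le> K"
  shows "real (card F) \<le> K ^ DIM('a)"
proof -
  have "real (card F) * \<rho> ^ DIM('a) \<le> (K * \<rho>) ^ DIM('a)"
    using disjoint_balls_sum_le[of F "\<lambda>_. \<rho>" c x "K * \<rho>"] assms by simp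
  then show ?thesis using \<open>0 < \<rho>\<close> by (simp add: power_mult_distrib)
qed

section \<open>The scale at which a finite point set is densest\<close>

text \<open>By minimality of \<rho>, no open ball of radius \<rho> about a point of the set holds
  more than \<open>q\<close> points, and the ball of radius \<open>3 * \<rho>\<close> is covered by
  boundedly many of these.\<close>

lemma finite_set_density_scale:
  fixes c :: "'i \<Rightarrow> 'a::euclidean_space"
  assumes fin: "finite A" and inj: "inj_on c A" and q: "2 \<le> q" "q \<le> card A"
  shows "\<exists>x \<rho>. 0 < \<rho> \<and> q \<le> card {i\<in>A. dist x (c i) \<le> \<rho>} \<and>
           card {i\<in>A. dist x (c i) \<le> 3 * \<rho>} \<le> 7 ^ DIM('a) * q"
proof -
  \<comment> \<open>the candidate radii are the finitely many distances between points of the set, so that a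
    minimal radius exists\<close>
  define D where "D = {(i, j). i \<in> A \<and> j \<in> A \<and> q \<le> card {l\<in>A. dist (c i) (c l) \<le> dist (c i) (c j)}}"
  define \<rho> where "\<rho> = Min ((\<lambda>(i, j). dist (c i) (c j)) ` D)"
  have "finite D" by (rule finite_subset[of _ "A \<times> A"]) (auto simp: D_def fin)
  have "D \<noteq> {}"
  proof -
    have "A \<noteq> {}" using q by auto
    then obtain i where i: "i \<in> A" by auto
    obtain j where j: "j \<in> A" "\<forall>l\<in>A. dist (c i) (c l) \<le> dist (c i) (c j)"
      using ex_is_arg_min_if_finite[OF fin \<open>A \<noteq> {}\<close>, of "\<lambda>l. - dist (c i) (c l)"]
      by (auto simp: is_arg_min_linorder)
    then have "{l\<in>A. dist (c i) (c l) \<le> dist (c i) (c j)} = A" by auto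
    with i j q have "(i, j) \<in> D" by (simp add: D_def)
    then show ?thesis by blast
  qed
  have "\<rho> \<in> (\<lambda>(i, j). dist (c i) (c j)) ` D"
    unfolding \<rho>_def using \<open>finite D\<close> \<open>D \<noteq> {}\<close> by (intro Min_in) auto
  then obtain i0 j0 where ij: "(i0, j0) \<in> D" "\<rho> = dist (c i0) (c j0)" by auto
  define x where "x = c i0"
  have many: "q \<le> card {i\<in>A. dist x (c i) \<le> \<rho>}" using ij by (simp add: D_def x_def)
  \<comment> \<open>A ball of radius 0 holds a single point by injectivity, fewer than the
    \<open>q\<close> required; this is where \<open>2 \<le> q\<close> enters.\<close>
  have "0 < \<rho>"
  proof (rule ccontr)
    assume "\<not> 0 < \<rho>"
    then have "{i\<in>A. dist x (c i) \<le> \<rho>} \<subseteq> {i0}"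
      using ij inj by (auto simp: D_def x_def inj_on_def)
    from card_mono[OF _ this] many q show False by simp
  qed
  \<comment> \<open>Otherwise the distance from \<open>c i\<close> to the farthest point of this
    open ball would be a candidate radius below \<rho>.\<close>
  have few: "card {l\<in>A. dist (c i) (c l) < \<rho>} \<le> q" if i: "i \<in> A" for i
  proof (rule ccontr)
    let ?B = "{l\<in>A. dist (c i) (c l) < \<rho>}"
    assume "\<not> card ?B \<le> q"
    then have "?B \<noteq> {}" by force
    then obtain j where j: "j \<in> ?B" "\<forall>l\<in>?B. dist (c i) (c l) \<le> dist (c i) (c j)"
      using ex_is_arg_min_if_finite[of ?B "\<lambda>l. - dist (c i) (c l)"] fin
      by (auto simp: is_arg_min_linorder)
    have "card ?B \<le> card {l\<in>A. dist (c i) (c l) \<le> dist (c i) (c j)}"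
      using j fin by (intro card_mono) auto
    with \<open>\<not> card ?B \<le> q\<close> i j have "(i, j) \<in> D" by (auto simp: D_def)
    then have "\<rho> \<le> dist (c i) (c j)"
      unfolding \<rho>_def using \<open>finite D\<close> by (intro Min_le) (auto intro!: rev_image_eqI)
    with j show False by auto
  qed
  define S where "S = {i\<in>A. dist x (c i) \<le> 3 * \<rho>}"
  \<comment> \<open>A maximal \<rho>-separated subset of \<open>S\<close> is a \<rho>-net: a point
    left uncovered could be added to it.\<close>
  define \<Q> where "\<Q> = {Q. Q \<subseteq> S \<and> (\<forall>i\<in>Q. \<forall>j\<in>Q. i \<noteq> j \<longrightarrow> \<rho> \<le> dist (c i) (c j))}"
  have "finite S" using fin by (simp add: S_def)
  then have "finite \<Q>" by (auto simp: \<Q>_def)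
  moreover have "{} \<in> \<Q>" by (simp add: \<Q>_def)
  ultimately obtain Q where Q: "Q \<in> \<Q>" and maxi: "\<And>Q'. Q' \<in> \<Q> \<Longrightarrow> Q \<subseteq> Q' \<Longrightarrow> Q = Q'"
    using finite_has_maximal[of \<Q>] by auto
  have "Q \<subseteq> S" "finite Q" using Q \<open>finite S\<close> by (auto simp: \<Q>_def intro: finite_subset)
  have cover: "S \<subseteq> (\<Union>i\<in>Q. {l\<in>A. dist (c i) (c l) < \<rho>})"
  proof
    fix l assume l: "l \<in> S"
    show "l \<in> (\<Union>i\<in>Q. {l\<in>A. dist (c i) (c l) < \<rho>})"
    proof (rule ccontr)
      assume n: "\<not> ?thesis"
      then have "insert l Q \<in> \<Q>"
        using Q l by (auto simp: \<Q>_def S_def dist_commute not_less)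
      with maxi[of "insert l Q"] have "l \<in> Q" by auto
      with n l \<open>0 < \<rho>\<close> show False by (auto simp: S_def)
    qed
  qed
  \<comment> \<open>Balls of radius \<open>\<rho> / 2\<close> about a separated set are disjoint,
    and \<open>3 * \<rho> + \<rho> / 2 = 7 * (\<rho> / 2)\<close> gives the constant 7.\<close>
  have "real (card Q) \<le> 7 ^ DIM('a)"
  proof (rule disjoint_balls_card_le[of _ "\<rho> / 2" c x])
    show "ball (c i) (\<rho> / 2) \<inter> ball (c j) (\<rho> / 2) = {}" if "i \<in> Q" "j \<in> Q" "i \<noteq> j" for i j
    proof -
      have "\<rho> \<le> dist (c i) (c j)" using Q that by (auto simp: \<Q>_def)
      then show ?thesis by (intro disjoint_ballI) simp
    qed
    show "ball (c i) (\<rho> / 2) \<subseteq> ball x (7 * (\<rho> / 2))" if "i \<in> Q" for i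
    proof -
      have "dist x (c i) \<le> 3 * \<rho>" using that \<open>Q \<subseteq> S\<close> by (auto simp: S_def)
      then show ?thesis by (simp add: ball_subset_ball_iff dist_commute)
    qed
  qed (use \<open>finite Q\<close> \<open>0 < \<rho>\<close> in auto)
  then have "real (card Q) \<le> real (7 ^ DIM('a))" by simp
  then have "card Q \<le> 7 ^ DIM('a)" by (simp only: of_nat_le_iff)
  have "card S \<le> card (\<Union>i\<in>Q. {l\<in>A. dist (c i) (c l) < \<rho>})"
    using cover fin \<open>finite Q\<close> by (intro card_mono) auto
  also have "\<dots> \<le> (\<Sum>i\<in>Q. card {l\<in>A. dist (c i) (c l) < \<rho>})"
    by (rule card_UN_le[OF \<open>finite Q\<close>])
  also have "\<dots> \<le> card Q * q"
    using few \<open>Q \<subseteq> S\<close> by (intro sum_bounded_above[where 'a = nat, simplified]) (auto simp: S_def)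
  also have "\<dots> \<le> 7 ^ DIM('a) * q" using \<open>card Q \<le> 7 ^ DIM('a)\<close> by simp
  finally show ?thesis using \<open>0 < \<rho>\<close> many unfolding S_def by blast
qed

section \<open>Ball packings and separating spheres\<close>

locale ball_packing =
  fixes V :: "'v set" and c :: "'v \<Rightarrow> 'a::euclidean_space" and r :: "'v \<Rightarrow> real"
  assumes radius_pos: "v \<in> V \<Longrightarrow> 0 < r v"
    and balls_disjoint: "u \<in> V \<Longrightarrow> v \<in> V \<Longrightarrow> u \<noteq> v \<Longrightarrow> ball (c u) (r u) \<inter> ball (c v) (r v) = {}"
begin

lemma inj_on_centres: "A \<subseteq> V \<Longrightarrow> inj_on c A"
  using radius_pos balls_disjoint
  by (intro inj_onI) (metis IntI centre_in_ball empty_iff subsetD)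

text \<open>
  A large ball contains a ball of radius \<open>\<rho>\<close> close to \<open>x\<close>, obtained by moving its centre towards \<open>x\<close>.
\<close>
lemma few_large_balls:
  assumes fin: "finite L" "L \<subseteq> V" and \<rho>: "0 < \<rho>"
    and large: "\<And>i. i \<in> L \<Longrightarrow> \<rho> < r i" and meet: "\<And>i. i \<in> L \<Longrightarrow> dist x (c i) \<le> 2 * \<rho> + r i"
  shows "real (card L) \<le> 4 ^ DIM('a)"
proof (rule disjoint_balls_card_le)
  \<comment> \<open>Chosen so that both estimates below are sharp when
    \<open>dist x (c i) = r i + 2 * \<rho>\<close>: the moved centre is then
    \<open>r i - \<rho>\<close> from \<open>c i\<close> and \<open>3 * \<rho>\<close> from
    \<open>x\<close>.\<close>
  define \<mu> where "\<mu> i = (r i - \<rho>) / (r i + 2 * \<rho>)" for i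
  define b where "b i = c i + \<mu> i *\<^sub>R (x - c i)" for i
  have \<mu>: "0 \<le> \<mu> i" "\<mu> i \<le> 1" "1 - \<mu> i = 3 * \<rho> / (r i + 2 * \<rho>)" if "i \<in> L" for i
    using large[OF that] \<rho> by (auto simp: \<mu>_def field_simps)
  have d1: "dist (c i) (b i) \<le> r i - \<rho>" if "i \<in> L" for i
  proof -
    have "dist (c i) (b i) = \<mu> i * dist x (c i)"
      using \<mu>[OF that] by (simp add: b_def dist_norm)
    also have "\<dots> \<le> \<mu> i * (2 * \<rho> + r i)" using \<mu>[OF that] meet[OF that] by (simp add: mult_left_mono)
    also have "\<dots> = r i - \<rho>" using large[OF that] \<rho> by (simp add: \<mu>_def field_simps)
    finally show ?thesis .
  qed
  have d2: "dist x (b i) \<le> 3 * \<rho>" if "i \<in> L" for i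
  proof -
    have "x - b i = (1 - \<mu> i) *\<^sub>R (x - c i)" by (simp add: b_def algebra_simps)
    then have "dist x (b i) = (1 - \<mu> i) * dist x (c i)"
      using \<mu>(2)[OF that] by (simp add: dist_norm)
    also have "\<dots> \<le> (1 - \<mu> i) * (2 * \<rho> + r i)"
      using \<mu>(2)[OF that] meet[OF that] by (simp add: mult_left_mono)
    also have "\<dots> = 3 * \<rho>" unfolding \<mu>(3)[OF that] using large[OF that] \<rho> by (simp add: field_simps)
    finally show ?thesis .
  qed
  have sub: "ball (b i) \<rho> \<subseteq> ball (c i) (r i)" if "i \<in> L" for i
    using d1[OF that] by (simp add: ball_subset_ball_iff dist_commute)
  show "ball (b i) \<rho> \<inter> ball (b j) \<rho> = {}" if "i \<in> L" "j \<in> L" "i \<noteq> j" for i j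
    using sub[OF that(1)] sub[OF that(2)] balls_disjoint[of i j] that fin(2) by blast
  show "ball (b i) \<rho> \<subseteq> ball x (4 * \<rho>)" if "i \<in> L" for i
    using d2[OF that] by (simp add: ball_subset_ball_iff dist_commute)
qed (use assms in auto)

text \<open>Volume controls only the sum of the \<open>d\<close>-th powers of the radii, whereas
  averaging over spheres needs the sum of the radii themselves. For \<open>s\<close> of order
  \<open>1/m\<close> and at most \<open>(7m)^d\<close> balls, both terms are of order
  \<open>m^(d-1)\<close>.\<close>

lemma sum_small_radii_le:
  fixes s :: real
  assumes fin: "finite F" "F \<subseteq> V" and \<rho>: "0 < \<rho>" and s: "0 < s"
    and small: "\<And>i. i \<in> F \<Longrightarrow> r i \<le> \<rho>" and near: "\<And>i. i \<in> F \<Longrightarrow> dist x (c i) \<le> 3 * \<rho>"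
  shows "(\<Sum>i\<in>F. r i / \<rho>) \<le> s * card F + 4 ^ DIM('a) / s ^ (DIM('a) - 1)"
proof -
  have "(\<Sum>i\<in>F. r i ^ DIM('a)) \<le> (4 * \<rho>) ^ DIM('a)"
  proof (rule disjoint_balls_sum_le)
    show "ball (c i) (r i) \<inter> ball (c j) (r j) = {}" if "i \<in> F" "j \<in> F" "i \<noteq> j" for i j
      using balls_disjoint that fin(2) by blast
    show "ball (c i) (r i) \<subseteq> ball x (4 * \<rho>)" if "i \<in> F" for i
      using small[OF that] near[OF that] by (simp add: ball_subset_ball_iff dist_commute)
    show "0 \<le> r i" if "i \<in> F" for i using radius_pos[of i] that fin(2) by auto
  qed (use fin \<rho> in auto)
  then have vol: "(\<Sum>i\<in>F. (r i / \<rho>) ^ DIM('a)) \<le> 4 ^ DIM('a)"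
    using \<rho> by (simp add: power_divide power_mult_distrib divide_le_eq flip: sum_divide_distrib)
  \<comment> \<open>replaces Hoelder's inequality: \<open>s\<close> is a threshold between tiny and larger radii\<close>
  have le: "y \<le> s + y ^ DIM('a) / s ^ (DIM('a) - 1)" if "0 \<le> y" for y
  proof (cases "y \<le> s")
    case True
    then show ?thesis using s that by (intro add_increasing2) auto
  next
    case False
    have "y * s ^ (DIM('a) - 1) \<le> y * y ^ (DIM('a) - 1)"
      using False s by (intro mult_left_mono power_mono) auto
    also have "\<dots> = y ^ DIM('a)" by (metis DIM_positive power_minus_mult mult.commute)
    finally have "y \<le> y ^ DIM('a) / s ^ (DIM('a) - 1)" using s by (simp add: field_simps)
    then show ?thesis using s by simp
  qed
  have "(\<Sum>i\<in>F. r i / \<rho>) \<le> (\<Sum>i\<in>F. s + (r i / \<rho>) ^ DIM('a) / s ^ (DIM('a) - 1))"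
    using radius_pos fin(2) \<rho> by (intro sum_mono le) (auto intro!: divide_nonneg_pos less_imp_le)
  also have "\<dots> = s * card F + (\<Sum>i\<in>F. (r i / \<rho>) ^ DIM('a)) / s ^ (DIM('a) - 1)"
    by (simp add: sum.distrib sum_divide_distrib)
  also have "\<dots> \<le> s * card F + 4 ^ DIM('a) / s ^ (DIM('a) - 1)"
    using vol s by (intro add_left_mono divide_right_mono) auto
  finally show ?thesis .
qed

text \<open>\<open>P\<close> collects the balls strictly inside a suitable sphere and
  \<open>T\<close> those that meet it; every other ball lies strictly outside and hence cannot touch
  a ball of \<open>P\<close>. The threshold \<open>s\<close> is left free until the scale is
  fixed.\<close>

lemma sphere_separator:
  fixes s :: real
  assumes fin: "finite A" and A: "A \<subseteq> V" and q: "2 \<le> q" "q \<le> card A" and s: "0 < s"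
  shows "\<exists>P T. P \<subseteq> A \<and> T \<subseteq> A \<and> P \<inter> T = {} \<and> card P \<le> 7 ^ DIM('a) * q \<and> q \<le> card (P \<union> T) \<and>
     real (card T) \<le> 2 * (s * (7 ^ DIM('a) * q) + 4 ^ DIM('a) / s ^ (DIM('a) - 1)) + 4 ^ DIM('a) \<and>
     (\<forall>u\<in>P. \<forall>v\<in>A - (P \<union> T). cball (c u) (r u) \<inter> cball (c v) (r v) = {})"
proof -
  obtain x \<rho> where \<rho>: "0 < \<rho>" and many: "q \<le> card {i\<in>A. dist x (c i) \<le> \<rho>}"
    and few: "card {i\<in>A. dist x (c i) \<le> 3 * \<rho>} \<le> 7 ^ DIM('a) * q"
    using finite_set_density_scale[OF fin inj_on_centres[OF A] q] by blast
  have pos: "0 < r i" if "i \<in> A" for i using radius_pos that A by auto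
  \<comment> \<open>A ball met by a sphere of radius between \<rho> and \<open>2 * \<rho>\<close>
    lies in \<open>F\<close> or in \<open>L\<close>. Averaging handles \<open>F\<close>; the members
    of \<open>L\<close> are boundedly many whichever radius is chosen.\<close>
  define F where "F = {i\<in>A. r i \<le> \<rho> \<and> dist x (c i) \<le> 3 * \<rho>}"
  define L where "L = {i\<in>A. \<rho> < r i \<and> dist x (c i) \<le> 2 * \<rho> + r i}"
  have "finite F" "finite L" using fin by (auto simp: F_def L_def)
  obtain t where t: "1 \<le> t" "t \<le> 2"
    and tF: "real (card {i\<in>F. (dist x (c i) - r i) / \<rho> \<le> t \<and> t \<le> (dist x (c i) + r i) / \<rho>})
      \<le> (\<Sum>i\<in>F. (dist x (c i) + r i) / \<rho> - (dist x (c i) - r i) / \<rho>)"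
    using exists_point_in_few_intervals[OF \<open>finite F\<close>, of "\<lambda>i. (dist x (c i) - r i) / \<rho>"
        "\<lambda>i. (dist x (c i) + r i) / \<rho>"] pos \<rho>
    by (force simp: F_def divide_right_mono less_imp_le)
  define P where "P = {i\<in>A. dist x (c i) + r i < t * \<rho>}"
  define T where "T = {i\<in>A. dist x (c i) - r i \<le> t * \<rho> \<and> t * \<rho> \<le> dist x (c i) + r i}"
  have t\<rho>: "\<rho> \<le> t * \<rho>" "t * \<rho> \<le> 2 * \<rho>" using t \<rho> by auto
  have "card P \<le> card {i\<in>A. dist x (c i) \<le> 3 * \<rho>}"
    using fin t\<rho> pos by (intro card_mono) (force simp: P_def)+
  \<comment> \<open>A ball centred within \<rho> of \<open>x\<close> cannot lie outside the sphere.
    This keeps \<open>P \<union> T\<close> large compared with \<open>T\<close>.\<close>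
  moreover have "card {i\<in>A. dist x (c i) \<le> \<rho>} \<le> card (P \<union> T)"
    using fin t\<rho> pos by (intro card_mono) (force simp: P_def T_def)+
  moreover have "real (card T) \<le> 2 * (s * (7 ^ DIM('a) * q) + 4 ^ DIM('a) / s ^ (DIM('a) - 1)) + 4 ^ DIM('a)"
  proof -
    let ?TF = "{i\<in>F. (dist x (c i) - r i) / \<rho> \<le> t \<and> t \<le> (dist x (c i) + r i) / \<rho>}"
    have "T \<subseteq> ?TF \<union> L"
    proof
      fix i assume i: "i \<in> T"
      show "i \<in> ?TF \<union> L"
      proof (cases "r i \<le> \<rho>")
        case True
        with i t\<rho> have "dist x (c i) \<le> 3 * \<rho>" by (simp add: T_def)
        with True i \<rho> show ?thesis by (simp add: T_def F_def field_simps)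
      next
        case False
        with i t\<rho> show ?thesis by (simp add: T_def L_def)
      qed
    qed
    then have "card T \<le> card (?TF \<union> L)"
      using \<open>finite F\<close> \<open>finite L\<close> by (intro card_mono) auto
    also have "\<dots> \<le> card ?TF + card L" by (rule card_Un_le)
    finally have "real (card T) \<le> real (card ?TF) + real (card L)" by linarith
    moreover have "real (card L) \<le> 4 ^ DIM('a)"
      using \<rho> \<open>finite L\<close> A by (intro few_large_balls[of _ \<rho> x]) (auto simp: L_def)
    moreover have "real (card ?TF) \<le> 2 * (\<Sum>i\<in>F. r i / \<rho>)"
    proof -
      have "(dist x (c i) + r i) / \<rho> - (dist x (c i) - r i) / \<rho> = 2 * (r i / \<rho>)" for i
        by (simp add: diff_divide_distrib add_divide_distrib)
      with tF show ?thesis by (simp only: sum_distrib_left)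
    qed
    moreover have "(\<Sum>i\<in>F. r i / \<rho>) \<le> s * card F + 4 ^ DIM('a) / s ^ (DIM('a) - 1)"
      using \<rho> \<open>finite F\<close> A s by (intro sum_small_radii_le[of _ _ _ x]) (auto simp: F_def)
    moreover have "s * card F \<le> s * (7 ^ DIM('a) * q)"
    proof -
      have "card F \<le> card {i\<in>A. dist x (c i) \<le> 3 * \<rho>}"
        using fin by (intro card_mono) (auto simp: F_def)
      with few have "card F \<le> 7 ^ DIM('a) * q" by linarith
      then have "real (card F) \<le> real (7 ^ DIM('a) * q)" by (rule of_nat_mono)
      then show ?thesis using s by simp
    qed
    ultimately have T: "real (card T) \<le> 2 * (\<Sum>i\<in>F. r i / \<rho>) + 4 ^ DIM('a)"
      and sum: "(\<Sum>i\<in>F. r i / \<rho>) \<le> s * (7 ^ DIM('a) * q) + 4 ^ DIM('a) / s ^ (DIM('a) - 1)"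
      by linarith+
    show ?thesis
      by (rule order_trans[OF T]) (intro add_right_mono mult_left_mono sum, simp)
  qed
  moreover have "cball (c u) (r u) \<inter> cball (c v) (r v) = {}" if "u \<in> P" "v \<in> A - (P \<union> T)" for u v
  proof (rule ccontr)
    assume "\<not> ?thesis"
    then obtain y where "dist (c u) y \<le> r u" "dist (c v) y \<le> r v" by auto
    moreover have "dist x (c u) + r u < t * \<rho>" "t * \<rho> < dist x (c v) - r v"
      using that by (auto simp: P_def T_def)
    ultimately show False
      using dist_triangle[of x "c v" y] dist_triangle[of x y "c u"] by (simp add: dist_commute)
  qed
  moreover have "P \<subseteq> A" "T \<subseteq> A" "P \<inter> T = {}" by (auto simp: P_def T_def)
  ultimately show ?thesis using few many by (intro exI[of _ P] exI[of _ T]) auto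
qed

end


section \<open>Carving a finite vertex set into pieces\<close>

text \<open>Induction on \<open>A\<close>: keep \<open>P\<close>, discard \<open>T\<close>, recurse
  on the rest. Edges are counted instead of boundary vertices because different pieces may share a
  boundary vertex but never an edge leaving them.\<close>

lemma division_edge_count:
  fixes E :: "('v \<times> 'v) set"
  assumes "sym E"
    and locfin: "\<And>v. v \<in> V \<Longrightarrow> finite (E `` {v})"
    and iso: "\<And>P. P \<subseteq> V \<Longrightarrow> finite P \<Longrightarrow> card P \<le> k \<Longrightarrow> \<eta> * real (card P) \<le> real (card (E `` P - P))"
    and sep: "\<And>A. A \<subseteq> V \<Longrightarrow> finite A \<Longrightarrow> k < card A \<Longrightarrow>
      \<exists>P T. P \<subseteq> A \<and> T \<subseteq> A \<and> P \<inter> T = {} \<and> P \<union> T \<noteq> {} \<and> card P \<le> k \<and>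
        real (card T) \<le> \<kappa> * real (card (P \<union> T)) \<and> E \<inter> P \<times> (A - (P \<union> T)) = {}"
    and \<kappa>: "0 \<le> \<kappa>"
    and A: "finite A" "A \<subseteq> V"
  shows "\<exists>B\<subseteq>A. real (card (A - B)) \<le> \<kappa> * real (card A) \<and>
           \<eta> * real (card B) \<le> real (card (E \<inter> B \<times> - B))"
  using A
proof (induction A rule: finite_psubset_induct)
  case (psubset A)
  have finE: "finite (E \<inter> B \<times> - B)" if "finite B" "B \<subseteq> V" for B
    by (rule finite_subset[of _ "SIGMA v:B. E `` {v}"]) (use locfin that in auto)
  have out: "\<eta> * real (card P) \<le> real (card (E \<inter> P \<times> - P))"
    if "P \<subseteq> V" "finite P" "card P \<le> k" for P
  proof -
    \<comment> \<open>Every boundary vertex is the end of at least one edge leaving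
      \<open>P\<close>.\<close>
    have "E `` P - P = snd ` (E \<inter> P \<times> - P)" by force
    then have "card (E `` P - P) \<le> card (E \<inter> P \<times> - P)"
      using card_image_le finE that by metis
    with iso[OF that] show ?thesis by linarith
  qed
  show ?case
  proof (cases "card A \<le> k")
    case True
    with out[of A] psubset.prems psubset.hyps \<kappa> show ?thesis by (intro exI[of _ A]) auto
  next
    case False
    then obtain P T where PT: "P \<subseteq> A" "T \<subseteq> A" "P \<inter> T = {}" "P \<union> T \<noteq> {}" "card P \<le> k"
      "real (card T) \<le> \<kappa> * real (card (P \<union> T))" and no: "E \<inter> P \<times> (A - (P \<union> T)) = {}"
      using sep[of A] psubset.prems psubset.hyps by (metis not_le)
    define A' where "A' = A - (P \<union> T)"
    have fin: "finite P" "finite T" "finite A'"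
      using PT psubset.hyps by (auto simp: A'_def intro: finite_subset)
    have "A' \<subset> A" "A' \<subseteq> V" using PT psubset.prems by (auto simp: A'_def)
    then obtain B' where B': "B' \<subseteq> A'" "real (card (A' - B')) \<le> \<kappa> * real (card A')"
      "\<eta> * real (card B') \<le> real (card (E \<inter> B' \<times> - B'))"
      using psubset.IH by blast
    have finB': "finite B'" using B' fin finite_subset by auto
    have disj: "P \<inter> B' = {}" using B' by (auto simp: A'_def)
    show ?thesis
    proof (intro exI[of _ "P \<union> B'"] conjI)
      show "P \<union> B' \<subseteq> A" using B' PT by (auto simp: A'_def)
      have "A - (P \<union> B') = T \<union> (A' - B')" using PT B' by (auto simp: A'_def)
      then have "real (card (A - (P \<union> B'))) \<le> real (card T) + real (card (A' - B'))"
        using card_Un_le[of T "A' - B'"] by simp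
      also have "\<dots> \<le> \<kappa> * (real (card (P \<union> T)) + real (card A'))"
        using PT B' by (simp add: distrib_left)
      also have "real (card (P \<union> T)) + real (card A') = real (card A)"
        using fin PT psubset.hyps
        by (simp add: A'_def card_Diff_subset card_mono of_nat_diff)
      finally show "real (card (A - (P \<union> B'))) \<le> \<kappa> * real (card A)" .
      \<comment> \<open>No edge joins \<open>P\<close> to \<open>B'\<close> in either direction, so
        edges leaving one of them also leave the union.\<close>
      have "E \<inter> (P \<union> B') \<times> - (P \<union> B') = (E \<inter> P \<times> - P) \<union> (E \<inter> B' \<times> - B')"
        using no B'(1) \<open>sym E\<close> by (auto simp: A'_def dest: symD)
      moreover have "(E \<inter> P \<times> - P) \<inter> (E \<inter> B' \<times> - B') = {}" using disj by auto
      moreover have "P \<subseteq> V" "B' \<subseteq> V" using PT psubset.prems B' \<open>A' \<subseteq> V\<close> by auto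
      ultimately have "card (E \<inter> (P \<union> B') \<times> - (P \<union> B')) = card (E \<inter> P \<times> - P) + card (E \<inter> B' \<times> - B')"
        using finE fin finB' by (simp add: card_Un_disjoint)
      moreover have "card (P \<union> B') = card P + card B'"
        using disj fin finB' by (simp add: card_Un_disjoint)
      ultimately show "\<eta> * real (card (P \<union> B')) \<le> real (card (E \<inter> (P \<union> B') \<times> - (P \<union> B')))"
        using out[of P] B'(3) PT(5) fin(1) \<open>P \<subseteq> V\<close> by (simp add: distrib_left)
    qed
  qed
qed

text \<open>Double counting: the at least \<open>\<eta> * card B\<close> edges leaving the pieces
  all end in discarded vertices or in the boundary of \<open>A\<close>, each of which receives at
  most \<Delta> of them. Few vertices are discarded, so the boundary must be large.\<close>

lemma boundary_ge_of_separators: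
  fixes E :: "('v \<times> 'v) set"
  assumes EV: "E \<subseteq> V \<times> V" and "sym E"
    and locfin: "\<And>v. v \<in> V \<Longrightarrow> finite (E `` {v})"
    and deg: "\<And>v. v \<in> V \<Longrightarrow> real (card (E `` {v})) \<le> \<Delta>"
    and iso: "\<And>P. P \<subseteq> V \<Longrightarrow> finite P \<Longrightarrow> card P \<le> k \<Longrightarrow> \<eta> * real (card P) \<le> real (card (E `` P - P))"
    and sep: "\<And>A. A \<subseteq> V \<Longrightarrow> finite A \<Longrightarrow> k < card A \<Longrightarrow>
      \<exists>P T. P \<subseteq> A \<and> T \<subseteq> A \<and> P \<inter> T = {} \<and> P \<union> T \<noteq> {} \<and> card P \<le> k \<and>
        real (card T) \<le> \<kappa> * real (card (P \<union> T)) \<and> E \<inter> P \<times> (A - (P \<union> T)) = {}"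
    and "0 \<le> \<kappa>" "0 \<le> \<eta>" "0 < \<Delta>"
    and A: "finite A" "A \<subseteq> V"
  shows "(\<eta> * (1 - \<kappa>) / \<Delta> - \<kappa>) * real (card A) \<le> real (card (E `` A - A))"
proof -
  have "\<exists>B\<subseteq>A. real (card (A - B)) \<le> \<kappa> * real (card A) \<and>
           \<eta> * real (card B) \<le> real (card (E \<inter> B \<times> - B))"
    by (rule division_edge_count[of E V k \<eta> \<kappa>]) (use assms in auto)
  then obtain B where B: "B \<subseteq> A" "real (card (A - B)) \<le> \<kappa> * real (card A)"
    "\<eta> * real (card B) \<le> real (card (E \<inter> B \<times> - B))" by auto
  define X where "X = (A - B) \<union> (E `` A - A)"
  have "finite (E `` A)"
    using A locfin by (subst Image_eq_UN) auto
  then have "finite X" using A by (simp add: X_def)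
  have "X \<subseteq> V" using A EV by (auto simp: X_def)
  \<comment> \<open>By symmetry the edges can be listed from their endpoints outside
    \<open>B\<close>.\<close>
  have "E \<inter> B \<times> - B \<subseteq> prod.swap ` (SIGMA v:X. E `` {v})"
    using B(1) \<open>sym E\<close> by (force simp: X_def dest: symD)
  moreover have finS: "finite (SIGMA v:X. E `` {v})"
    using \<open>finite X\<close> \<open>X \<subseteq> V\<close> locfin by auto
  ultimately have "card (E \<inter> B \<times> - B) \<le> card (SIGMA v:X. E `` {v})"
    by (meson card_image_le card_mono finite_imageI order_trans)
  also have "\<dots> = (\<Sum>v\<in>X. card (E `` {v}))"
    using \<open>finite X\<close> \<open>X \<subseteq> V\<close> locfin by (subst card_SigmaI) auto
  finally have "real (card (E \<inter> B \<times> - B)) \<le> (\<Sum>v\<in>X. real (card (E `` {v})))"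
    by (metis of_nat_mono of_nat_sum)
  also have "\<dots> \<le> real (card X) * \<Delta>"
    using deg \<open>X \<subseteq> V\<close> by (intro sum_bounded_above) auto
  also have "\<dots> \<le> (\<kappa> * real (card A) + real (card (E `` A - A))) * \<Delta>"
    using card_Un_le[of "A - B" "E `` A - A"] B(2) \<open>0 < \<Delta>\<close>
    by (intro mult_right_mono) (auto simp: X_def)
  finally have "\<eta> * real (card B) \<le> (\<kappa> * real (card A) + real (card (E `` A - A))) * \<Delta>"
    using B(3) by linarith
  moreover have "(1 - \<kappa>) * real (card A) \<le> real (card B)"
    using B A by (simp add: card_Diff_subset finite_subset of_nat_diff card_mono algebra_simps)
  then have "\<eta> * ((1 - \<kappa>) * real (card A)) \<le> \<eta> * real (card B)"
    using \<open>0 \<le> \<eta>\<close> by (rule mult_left_mono)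
  ultimately have "\<eta> * ((1 - \<kappa>) * real (card A)) \<le> (\<kappa> * real (card A) + real (card (E `` A - A))) * \<Delta>"
    by linarith
  then show ?thesis using \<open>0 < \<Delta>\<close> by (simp add: field_simps)
qed

section \<open>Degree bound and separators at scale \<open>m\<close>\<close>

context ball_packing
begin

text \<open>Each neighbour has radius at least \<open>r v / M\<close>, so concentric balls of that
  radius stay disjoint; they fit into the ball of radius \<open>(M + 1) * r v + r v / M\<close>
  about \<open>c v\<close>.\<close>

lemma tangency_degree_le:
  assumes v: "v \<in> V" and U: "finite U" "U \<subseteq> V" and "0 < M"
    and touch: "\<And>u. u \<in> U \<Longrightarrow> cball (c v) (r v) \<inter> cball (c u) (r u) \<noteq> {}"
    and ratio: "\<And>u. u \<in> U \<Longrightarrow> r u \<le> M * r v" "\<And>u. u \<in> U \<Longrightarrow> r v \<le> M * r u"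
  shows "real (card U) \<le> ((M + 1) * M + 1) ^ DIM('a)"
proof (rule disjoint_balls_card_le[of _ "r v / M" c "c v"])
  show "0 < r v / M" using radius_pos[OF v] \<open>0 < M\<close> by simp
  have le: "r v / M \<le> r u" if "u \<in> U" for u
    using ratio(2)[OF that] \<open>0 < M\<close> by (simp add: field_simps)
  show "ball (c u) (r v / M) \<inter> ball (c w) (r v / M) = {}" if "u \<in> U" "w \<in> U" "u \<noteq> w" for u w
    using balls_disjoint[of u w] le[OF that(1)] le[OF that(2)] that U
      subset_ball[of "r v / M" "r u" "c u"] subset_ball[of "r v / M" "r w" "c w"] by blast
  show "ball (c u) (r v / M) \<subseteq> ball (c v) (((M + 1) * M + 1) * (r v / M))" if u: "u \<in> U" for u
  proof -
    obtain y where "dist (c v) y \<le> r v" "dist (c u) y \<le> r u" using touch[OF u] by auto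
    then have "dist (c u) (c v) \<le> r u + r v" by metric
    also have "\<dots> \<le> (M + 1) * r v" using ratio(1)[OF u] by (simp add: algebra_simps)
    also have "\<dots> + r v / M = ((M + 1) * M + 1) * (r v / M)"
      using \<open>0 < M\<close> by (simp add: field_simps)
    finally show ?thesis by (simp add: ball_subset_ball_iff)
  qed
qed (use assms in auto)

text \<open>Take \<open>q = m^d\<close>. The sphere meets at most \<open>C * m^(d-1)\<close> balls,
  and since \<open>P \<union> T\<close> has at least \<open>m^d\<close> elements, this is a
  proportion at most \<open>C / m\<close>.\<close>

lemma scaled_sphere_separator:
  fixes m :: nat
  defines "C \<equiv> (2 + 3 * 4 ^ DIM('a)) * 7 ^ (DIM('a) - 1) :: real"
  assumes A: "A \<subseteq> V" "finite A" and m: "2 \<le> m" and big: "(7 * m) ^ DIM('a) < card A"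
  shows "\<exists>P T. P \<subseteq> A \<and> T \<subseteq> A \<and> P \<inter> T = {} \<and> P \<union> T \<noteq> {} \<and> card P \<le> (7 * m) ^ DIM('a) \<and>
    real (card T) \<le> C / real m * real (card (P \<union> T)) \<and>
    (\<forall>u\<in>P. \<forall>v\<in>A - (P \<union> T). cball (c u) (r u) \<inter> cball (c v) (r v) = {})"
proof -
  have "m ^ 1 \<le> m ^ DIM('a)" using m DIM_positive[where 'a = 'a] by (intro power_increasing) auto
  then have q2: "2 \<le> m ^ DIM('a)" using m by simp
  have "m ^ DIM('a) \<le> (7 * m) ^ DIM('a)" by (intro power_mono) auto
  with big have qA: "m ^ DIM('a) \<le> card A" by linarith
  \<comment> \<open>This value balances the two error terms: they become \<open>Y\<close> and
    \<open>4^d * Y\<close> with \<open>Y = (7m)^(d-1)\<close>.\<close>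
  define s where "s = 1 / (7 * real m)"
  have "0 < s" using m by (simp add: s_def)
  obtain P T where PT: "P \<subseteq> A" "T \<subseteq> A" "P \<inter> T = {}" "card P \<le> 7 ^ DIM('a) * m ^ DIM('a)"
    "m ^ DIM('a) \<le> card (P \<union> T)"
    and T: "real (card T) \<le> 2 * (s * (7 ^ DIM('a) * real (m ^ DIM('a))) + 4 ^ DIM('a) / s ^ (DIM('a) - 1)) + 4 ^ DIM('a)"
    and no: "\<forall>u\<in>P. \<forall>v\<in>A - (P \<union> T). cball (c u) (r u) \<inter> cball (c v) (r v) = {}"
    using sphere_separator[OF A(2,1) q2 qA \<open>0 < s\<close>] by auto
  define Y where "Y = (7 * real m) ^ (DIM('a) - 1)"
  have Y1: "1 \<le> Y" unfolding Y_def using m by (intro one_le_power) simp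
  have pow: "y ^ DIM('a) = y * y ^ (DIM('a) - 1)" for y :: real
    by (metis DIM_positive power_minus_mult mult.commute)
  have "s * (7 ^ DIM('a) * real (m ^ DIM('a))) = Y"
    using pow[of "7 * real m"] m by (simp add: s_def Y_def power_mult_distrib)
  moreover have "4 ^ DIM('a) / s ^ (DIM('a) - 1) = 4 ^ DIM('a) * Y"
    by (simp add: s_def Y_def power_divide)
  ultimately have "real (card T) \<le> 2 * (Y + 4 ^ DIM('a) * Y) + 4 ^ DIM('a)"
    using T by simp
  \<comment> \<open>The additive constant is absorbed using \<open>1 \<le> Y\<close>, which produces
    the factor \<open>2 + 3 * 4^d\<close> of \<open>C\<close>.\<close>
  also have "\<dots> \<le> 2 * (Y + 4 ^ DIM('a) * Y) + 4 ^ DIM('a) * Y"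
    using Y1 by simp
  also have "\<dots> = C / real m * real (m ^ DIM('a))"
    using m pow[of "real m"] by (simp add: C_def Y_def power_mult_distrib field_simps)
  also have "\<dots> \<le> C / real m * real (card (P \<union> T))"
    using PT(5) by (intro mult_left_mono of_nat_mono) (auto simp: C_def)
  finally have "real (card T) \<le> C / real m * real (card (P \<union> T))" .
  moreover have "P \<union> T \<noteq> {}" using PT(5) q2 by (metis card.empty le_zero_eq not_numeral_le_zero order_trans)
  ultimately show ?thesis
    using PT no by (intro exI[of _ P] exI[of _ T]) (auto simp: power_mult_distrib)
qed

end


section \<open>Connectedness, transport of the packing, and the Cheeger constant\<close>

text \<open>A nonempty set closed under adjacency is everything in a connected graph. This supplies
  the boundary bound for pieces too small for the growth assumption.\<close>

lemma Image_Diff_ne_empty_of_connected: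
  fixes G :: "'v pair_pre_digraph"
  assumes "pair_bidirected_digraph G" and "infinite (pverts G)"
    and conn: "Digraph_Component.connected (with_proj G)"
    and W: "W \<subseteq> pverts G" "finite W" "W \<noteq> {}"
  shows "parcs G `` W - W \<noteq> {}"
proof
  interpret pair_bidirected_digraph G by fact
  assume "parcs G `` W - W = {}"
  then have closed: "v \<in> W" if "(u, v) \<in> parcs G" "u \<in> W" for u v using that by auto
  obtain w where w: "w \<in> W" using W by auto
  have "v \<in> W" if "v \<in> pverts G" for v
  proof -
    have "sym (parcs G)" using pair_sym_arcs by (simp add: symmetric_def)
    \<comment> \<open>Connectedness refers to the symmetrized digraph, which here has the same arcs
      as \<open>G\<close>.\<close>
    then have "arcs_ends (mk_symmetric (with_proj G)) = parcs G"
      by (auto simp: mk_symmetric_def parcs_mk_symmetric dest: symD)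
    moreover have "w \<rightarrow>\<^sup>*\<^bsub>mk_symmetric (with_proj G)\<^esub> v"
      using conn that w W by (auto simp: connected_def strongly_connected_def)
    ultimately have "(w, v) \<in> (parcs G)\<^sup>*"
      unfolding reachable_def by (metis rtrancl_on_rtranclI)
    then show ?thesis by induction (use w closed in auto)
  qed
  with W \<open>infinite (pverts G)\<close> show False by (metis finite_subset subsetI)
qed

text \<open>Pulling centres and radii back along the inverse of the isomorphism indexes the packing
  by the vertices of \<open>G\<close> itself.\<close>

lemma admits_uniform_packingE:
  fixes G :: "'v pair_pre_digraph"
  assumes "admits_uniform_packing TYPE('n::finite) M G"
  obtains c :: "'v \<Rightarrow> real ^ 'n" and r where "ball_packing (pverts G) c r"
    and "\<And>u v. (u, v) \<in> parcs G \<Longrightarrow> cball (c u) (r u) \<inter> cball (c v) (r v) \<noteq> {} \<and> r u / r v \<le> M"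
proof -
  obtain V and c :: "'v \<Rightarrow> real ^ 'n" and r where up: "uniform_packing M V c r"
    and "digraph_iso (with_proj (tangency_graph V c r)) (with_proj G)"
    using assms by (auto simp: admits_uniform_packing_def)
  then obtain f where f: "pre_digraph.digraph_isomorphism (with_proj (tangency_graph V c r)) f"
    and G: "with_proj G = app_iso f (with_proj (tangency_graph V c r))"
    by (auto simp: digraph_iso_def)
  let ?f = "iso_verts f"
  define g where "g = the_inv_into V ?f"
  have inj: "inj_on ?f V"
    using f by (simp add: pre_digraph.digraph_isomorphism_def tangency_graph_def)
  have verts: "pverts G = ?f ` V"
    using arg_cong[OF G, of verts] by (simp add: verts_app_iso tangency_graph_def)
  have arcs: "parcs G = iso_arcs f ` parcs (tangency_graph V c r)"
    using arg_cong[OF G, of arcs] by (simp add: arcs_app_iso)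
  \<comment> \<open>Both digraphs have the projections as tail and head, so the arc map acts on
    pairs through the vertex map.\<close>
  have ends: "iso_tail f = fst" "iso_head f = snd"
    using arg_cong[OF G, of tail] arg_cong[OF G, of head] by (simp_all add: tail_app_iso head_app_iso)
  have g: "g v \<in> V" "?f (g v) = v" if "v \<in> pverts G" for v
    using that inj unfolding verts g_def
    by (auto intro: the_inv_into_into f_the_inv_into_f)
  have "ball_packing (pverts G) (c \<circ> g) (r \<circ> g)"
  proof
    show "0 < (r \<circ> g) v" if "v \<in> pverts G" for v
      using up g[OF that] by (auto simp: uniform_packing_def sphere_packing_def)
    show "ball ((c \<circ> g) u) ((r \<circ> g) u) \<inter> ball ((c \<circ> g) v) ((r \<circ> g) v) = {}"
      if "u \<in> pverts G" "v \<in> pverts G" "u \<noteq> v" for u v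
    proof -
      have "g u \<noteq> g v" using g[OF that(1)] g[OF that(2)] that(3) by metis
      then show ?thesis
        using up g[OF that(1)] g[OF that(2)] by (auto simp: uniform_packing_def sphere_packing_def)
    qed
  qed
  moreover have "cball ((c \<circ> g) u) ((r \<circ> g) u) \<inter> cball ((c \<circ> g) v) ((r \<circ> g) v) \<noteq> {} \<and>
      (r \<circ> g) u / (r \<circ> g) v \<le> M" if uv: "(u, v) \<in> parcs G" for u v
  proof -
    obtain a where a: "(u, v) = iso_arcs f a" "a \<in> parcs (tangency_graph V c r)"
      using uv unfolding arcs by (rule imageE)
    then have aV: "fst a \<in> V" "snd a \<in> V"
      and tang: "tangent_balls (c (fst a)) (r (fst a)) (c (snd a)) (r (snd a))"
      by (auto simp: tangency_graph_def)
    have "fst (iso_arcs f a) = u" "snd (iso_arcs f a) = v" by (simp_all flip: a(1))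
    then have "?f (fst a) = u" "?f (snd a) = v"
      using f a(2) ends by (auto simp: pre_digraph.digraph_isomorphism_def)
    then have "g u = fst a" "g v = snd a"
      using inj aV by (auto simp: g_def the_inv_into_f_f)
    then show ?thesis
      using tang up aV by (auto simp: uniform_packing_def tangent_balls_def)
  qed
  ultimately show thesis by (rule that)
qed

lemma cheeger_pos_of_boundary_ge:
  assumes "infinite (pverts G)" and "0 < h"
    and "\<And>W. W \<subseteq> pverts G \<Longrightarrow> finite W \<Longrightarrow> W \<noteq> {} \<Longrightarrow> h * real (card W) \<le> real (card (vertex_boundary G W))"
  shows "0 < cheeger G"
proof -
  obtain v where "v \<in> pverts G" using assms(1) by fastforce
  have "h \<le> cheeger G"
    unfolding cheeger_def
  proof (rule cInf_greatest)
    show "{real (card (vertex_boundary G W)) / real (card W) |W. W \<subseteq> pverts G \<and> finite W \<and> W \<noteq> {}} \<noteq> {}"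
      using \<open>v \<in> pverts G\<close> by (auto intro!: exI[of _ "{v}"])
  next
    fix x assume "x \<in> {real (card (vertex_boundary G W)) / real (card W) |W. W \<subseteq> pverts G \<and> finite W \<and> W \<noteq> {}}"
    then obtain W where W: "W \<subseteq> pverts G" "finite W" "W \<noteq> {}"
      and x: "x = real (card (vertex_boundary G W)) / real (card W)" by auto
    then have "0 < card W" by (simp add: card_gt_0_iff)
    with assms(3)[OF W] show "h \<le> x" by (simp add: x pos_le_divide_eq)
  qed
  with \<open>0 < h\<close> show ?thesis by linarith
qed

section \<open>Choice of the scale and the alternative\<close>

text \<open>The proportion of deleted vertices decays like \<open>1/m\<close>, strictly faster than
  the expansion \<open>m^(\<alpha>-1)\<close> of the pieces.\<close>

lemma exists_large_scale:
  fixes \<alpha> K B :: real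
  assumes "0 < \<alpha>" and "0 < B"
  shows "\<exists>m\<ge>2. K / real m < (7 * real m) powr (\<alpha> - 1) \<and> K / real m < B \<and> K / real m \<le> 1"
proof -
  have "\<forall>\<^sub>F m in sequentially. K / real m < (7 * real m) powr (\<alpha> - 1)"
    using assms by real_asymp
  moreover have "(\<lambda>m. K / real m) \<longlonglongrightarrow> 0" by real_asymp
  then have "\<forall>\<^sub>F m in sequentially. K / real m < min B 1"
    by (rule order_tendstoD) (use assms in auto)
  ultimately have "\<forall>\<^sub>F m in sequentially. 2 \<le> m \<and> K / real m < (7 * real m) powr (\<alpha> - 1) \<and> K / real m < B \<and> K / real m \<le> 1"
    using eventually_ge_at_top[of 2] by eventually_elim auto
  then show ?thesis by (rule eventually_happens'[OF sequentially_bot])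
qed

theorem corollary4p2:
  fixes G :: "'v pair_pre_digraph" and M :: real
  assumes "CARD('n::finite) \<ge> 2" and "M > 0"
    and "pair_bidirected_digraph G"
    and "infinite (pverts G)"
    and "locally_finite_graph G"
    and "Digraph_Component.connected (with_proj G)"
    and "admits_uniform_packing TYPE('n) M G"
  shows "cheeger G > 0 \<or>
    (\<forall>\<epsilon>>0. \<forall>N::nat. \<exists>W. W \<subseteq> pverts G \<and> finite W \<and> card W \<ge> N \<and>
       real (card (vertex_boundary G W))
         \<le> real (card W) powr ((real CARD('n) - 1) / real CARD('n) + \<epsilon>))"
proof (rule disjCI)
  let ?d = "CARD('n)"
  interpret pair_bidirected_digraph G by fact
  assume "\<not> (\<forall>\<epsilon>>0. \<forall>N::nat. \<exists>W. W \<subseteq> pverts G \<and> finite W \<and> card W \<ge> N \<and>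
       real (card (vertex_boundary G W)) \<le> real (card W) powr ((real ?d - 1) / real ?d + \<epsilon>))"
  then obtain \<epsilon> N where "0 < \<epsilon>"
    and large: "\<And>W. W \<subseteq> pverts G \<Longrightarrow> finite W \<Longrightarrow> N \<le> card W \<Longrightarrow>
       real (card W) powr ((real ?d - 1) / real ?d + \<epsilon>) < real (card (vertex_boundary G W))"
    by (meson not_le)
  obtain c :: "'v \<Rightarrow> real ^ 'n" and r where bp: "ball_packing (pverts G) c r"
    and tang: "\<And>u v. (u, v) \<in> parcs G \<Longrightarrow> cball (c u) (r u) \<inter> cball (c v) (r v) \<noteq> {} \<and> r u / r v \<le> M"
    using admits_uniform_packingE[OF assms(7)] by metis
  interpret ball_packing "pverts G" c r by fact
  let ?E = "parcs G"
  have EV: "?E \<subseteq> pverts G \<times> pverts G" using in_arcsD1 in_arcsD2 by auto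
  have "sym ?E" using pair_sym_arcs by (simp add: symmetric_def)
  have bd: "vertex_boundary G W = ?E `` W - W" for W
    using EV by (auto simp: vertex_boundary_def)
  have locfin: "finite (?E `` {v})" if "v \<in> pverts G" for v
    using assms(5) that by (simp add: locally_finite_graph_def Image_singleton)
  define \<Delta> where "\<Delta> = ((M + 1) * M + 1) ^ ?d"
  have "0 < \<Delta>" using \<open>M > 0\<close> by (simp add: \<Delta>_def add_pos_pos)
  have deg: "real (card (?E `` {v})) \<le> \<Delta>" if v: "v \<in> pverts G" for v
  proof -
    \<comment> \<open>Symmetry of the arcs turns the one-sided ratio bound into a two-sided
      one.\<close>
    have "r u \<le> M * r v \<and> r v \<le> M * r u" if "(v, u) \<in> ?E" for u
      using tang[OF that] tang[OF symD[OF \<open>sym ?E\<close> that]] radius_pos[OF in_arcsD1[OF that]]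
        radius_pos[OF in_arcsD2[OF that]] by (simp add: field_simps)
    then have "real (card (?E `` {v})) \<le> ((M + 1) * M + 1) ^ DIM(real ^ 'n)"
      using v locfin[OF v] EV tang \<open>M > 0\<close> by (intro tangency_degree_le) auto
    then show ?thesis by (simp add: \<Delta>_def)
  qed
  define C :: real where "C = (2 + 3 * 4 ^ ?d) * 7 ^ (?d - 1)"
  have "0 < C" by (simp add: C_def add_pos_pos)
  \<comment> \<open>makes the exponent \<open>\<epsilon>' - 1 / d\<close> nonpositive, so that the bound over the pieces is worst at
    the maximal size\<close>
  define \<epsilon>' where "\<epsilon>' = min \<epsilon> (1 / real ?d)"
  have \<epsilon>': "0 < \<epsilon>'" "\<epsilon>' \<le> \<epsilon>" "\<epsilon>' \<le> 1 / real ?d" using \<open>0 < \<epsilon>\<close> by (auto simp: \<epsilon>'_def)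
  \<comment> \<open>The two entries yield \<open>2 * \<kappa> \<le> 1\<close> and
    \<open>2 * \<Delta> * \<kappa> < \<eta>\<close> respectively.\<close>
  define K where "K = max (2 * C) (2 * \<Delta> * C)"
  have "\<exists>m\<ge>2. K / real m < (7 * real m) powr (real ?d * \<epsilon>' - 1) \<and> K / real m < 1 / (real N + 1) \<and> K / real m \<le> 1"
    by (rule exists_large_scale) (use \<epsilon>' in auto)
  then obtain m :: nat where m: "2 \<le> m" "K / real m < (7 * real m) powr (real ?d * \<epsilon>' - 1)"
    "K / real m < 1 / (real N + 1)" "K / real m \<le> 1" by blast
  define \<kappa> where "\<kappa> = C / real m"
  \<comment> \<open>The first entry serves pieces with at least \<open>N\<close> vertices, the
    second smaller ones, whose boundary has at least one vertex. Adding 1 to \<open>N\<close> keeps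
    the denominator positive.\<close>
  define \<eta> where "\<eta> = min ((7 * real m) powr (real ?d * \<epsilon>' - 1)) (1 / (real N + 1))"
  have "0 < \<kappa>" using \<open>0 < C\<close> m by (simp add: \<kappa>_def)
  have "2 * C / real m \<le> K / real m" "2 * \<Delta> * C / real m \<le> K / real m"
    by (auto simp: K_def intro!: divide_right_mono)
  with m have "2 * C / real m \<le> 1" "2 * \<Delta> * C / real m < \<eta>" unfolding \<eta>_def by linarith+
  then have "2 * \<kappa> \<le> 1" "2 * \<Delta> * \<kappa> < \<eta>" by (simp_all add: \<kappa>_def)
  have "0 < \<eta>" using m by (simp add: \<eta>_def)
  have iso: "\<eta> * real (card P) \<le> real (card (?E `` P - P))"
    if P: "P \<subseteq> pverts G" "finite P" "card P \<le> (7 * m) ^ ?d" for P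
  proof (cases "P = {}")
    case False
    then have pos: "1 \<le> real (card P)" using P by (simp add: Suc_le_eq card_gt_0_iff)
    show ?thesis
    proof (cases "N \<le> card P")
      case True
      have "\<eta> \<le> (7 * real m) powr (real ?d * \<epsilon>' - 1)" by (simp add: \<eta>_def)
      also have "\<dots> = ((7 * real m) powr real ?d) powr (\<epsilon>' - 1 / real ?d)"
        by (simp add: powr_powr algebra_simps)
      also have "(7 * real m) powr real ?d = real ((7 * m) ^ ?d)"
        using m by (simp add: powr_realpow)
      also have "\<dots> powr (\<epsilon>' - 1 / real ?d) \<le> real (card P) powr (\<epsilon>' - 1 / real ?d)"
      proof (intro powr_mono2')
        show "real (card P) \<le> real ((7 * m) ^ ?d)" using P(3) by (rule of_nat_mono)
      qed (use pos \<epsilon>' in auto)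
      finally have "\<eta> * real (card P) \<le> real (card P) powr (\<epsilon>' - 1 / real ?d) * real (card P) powr 1"
        using pos by (simp add: mult_right_mono)
      also have "\<dots> = real (card P) powr ((real ?d - 1) / real ?d + \<epsilon>')"
      proof -
        have "(real ?d - 1) / real ?d + \<epsilon>' = (\<epsilon>' - 1 / real ?d) + 1"
          by (simp add: diff_divide_distrib)
        then show ?thesis by (simp only: powr_add)
      qed
      also have "\<dots> \<le> real (card P) powr ((real ?d - 1) / real ?d + \<epsilon>)"
        using pos \<epsilon>' by (intro powr_mono) auto
      also have "\<dots> \<le> real (card (?E `` P - P))"
        using large[OF P(1,2) True] by (simp add: bd)
      finally show ?thesis .
    next
      case small: False
      have "?E `` P - P \<noteq> {}"
        using Image_Diff_ne_empty_of_connected[OF assms(3,4,6) P(1,2) False] .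
      moreover have "finite (?E `` P)" using P locfin by (subst Image_eq_UN) auto
      ultimately have "1 \<le> real (card (?E `` P - P))" by (simp add: Suc_le_eq card_gt_0_iff)
      moreover have "\<eta> * real (card P) \<le> 1 / (real N + 1) * (real N + 1)"
        using small by (intro mult_mono) (auto simp: \<eta>_def)
      ultimately show ?thesis by simp
    qed
  qed auto
  have sep: "\<exists>P T. P \<subseteq> A \<and> T \<subseteq> A \<and> P \<inter> T = {} \<and> P \<union> T \<noteq> {} \<and> card P \<le> (7 * m) ^ ?d \<and>
        real (card T) \<le> \<kappa> * real (card (P \<union> T)) \<and> ?E \<inter> P \<times> (A - (P \<union> T)) = {}"
    if A: "A \<subseteq> pverts G" "finite A" "(7 * m) ^ ?d < card A" for A
  proof -
    obtain P T where "P \<subseteq> A" "T \<subseteq> A" "P \<inter> T = {}" "P \<union> T \<noteq> {}" "card P \<le> (7 * m) ^ ?d"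
      "real (card T) \<le> \<kappa> * real (card (P \<union> T))"
      and no: "\<forall>u\<in>P. \<forall>v\<in>A - (P \<union> T). cball (c u) (r u) \<inter> cball (c v) (r v) = {}"
      using scaled_sphere_separator[OF A(1,2) m(1)] A(3) by (auto simp: \<kappa>_def C_def)
    moreover have "?E \<inter> P \<times> (A - (P \<union> T)) = {}" using no tang by blast
    ultimately show ?thesis by blast
  qed
  show "0 < cheeger G"
  proof (rule cheeger_pos_of_boundary_ge[OF assms(4)])
    \<comment> \<open>As \<kappa> is at most one half, \<open>1 - \<kappa>\<close> costs at most a
      factor 2, which the 2 in \<open>2 * \<Delta> * \<kappa> < \<eta>\<close> pays for.\<close>
    have "2 * \<kappa> * \<Delta> < \<eta>" using \<open>2 * \<Delta> * \<kappa> < \<eta>\<close> by (simp add: mult_ac)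
    also have "\<eta> \<le> \<eta> * (2 * (1 - \<kappa>))" using \<open>2 * \<kappa> \<le> 1\<close> \<open>0 < \<eta>\<close> by simp
    finally show "0 < \<eta> * (1 - \<kappa>) / \<Delta> - \<kappa>" using \<open>0 < \<Delta>\<close> by (simp add: field_simps)
    show "(\<eta> * (1 - \<kappa>) / \<Delta> - \<kappa>) * real (card W) \<le> real (card (vertex_boundary G W))"
      if "W \<subseteq> pverts G" "finite W" "W \<noteq> {}" for W
      unfolding bd
      by (rule boundary_ge_of_separators[OF EV \<open>sym ?E\<close> locfin deg iso sep])
        (use that \<open>0 < \<kappa>\<close> \<open>0 < \<eta>\<close> \<open>0 < \<Delta>\<close> in auto)
  qed
qed

end
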